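(* Every locally stable Bézout duo-domain is an elementary divisor ring.
   Context: All rings are associative with an identity, not necessarily commutative. A matrix $A$ (not necessarily square) over a ring $R$ admits diagonal reduction if there exist invertible matrices $P$ and $Q$ over $R$ such that $PAQ$ is a diagonal matrix $(d_{ij})$ with $Rd_{(i+1)(i+1)}R\subseteq d_{ii}R\cap Rd_{ii}$ for each $i$. A ring $R$ is an elementary divisor ring if every matrix over $R$ admits a diagonal reduction. A ring is a Bézout ring if every finitely generated right ideal and every finitely generated left ideal is principal. A ring is duo if every right ideal and every left ideal is a two-sided ideal. A domain is a ring with no nonzero zero divisors (not necessarily commutative). A Bézout duo-domain is a ring that is Bézout, duo and a domain. A ring $R$ has stable range 1 if whenever $aR+bR=R$ with $a,b\in R$ there exists $y\in R$ such that $a+by$ is invertible. An element $a$ of a duo ring $R$ is stable if the ring $R/aR$ has stable range 1. A duo ring $R$ is locally stable if whenever $aR+bR=R$ with $a,b\in R$ there exists $y\in R$ such that $a+by$ is stable. *)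

theory Defs
  imports "Jordan_Normal_Form.VS_Connect" "HOL-Algebra.QuotRing"
begin

text \<open>
  The ambient ring is a type of class \<open>ring_1\<close> (associative, with identity, not necessarily
  commutative; the class makes it nontrivial). The same ring as a HOL-Algebra structure is
  \<open>class_ring\<close>, which is used to form quotient rings.
\<close>

definition right_ideal :: "'a::ring_1 set \<Rightarrow> bool" where
  "right_ideal I \<longleftrightarrow>
    0 \<in> I \<and> (\<forall>x\<in>I. \<forall>y\<in>I. x + y \<in> I) \<and> (\<forall>x\<in>I. \<forall>r. x * r \<in> I)"

definition left_ideal :: "'a::ring_1 set \<Rightarrow> bool" where
  "left_ideal I \<longleftrightarrow>
    0 \<in> I \<and> (\<forall>x\<in>I. \<forall>y\<in>I. x + y \<in> I) \<and> (\<forall>x\<in>I. \<forall>r. r * x \<in> I)"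

definition two_sided_ideal :: "'a::ring_1 set \<Rightarrow> bool" where
  "two_sided_ideal I \<longleftrightarrow> right_ideal I \<and> left_ideal I"

definition right_multiples :: "'a::ring_1 \<Rightarrow> 'a set" where
  "right_multiples a = range (\<lambda>r. a * r)"

definition left_multiples :: "'a::ring_1 \<Rightarrow> 'a set" where
  "left_multiples a = range (\<lambda>r. r * a)"

definition bezout_ring :: "'a::ring_1 itself \<Rightarrow> bool" where
  "bezout_ring _ \<longleftrightarrow>
    (\<forall>F :: 'a set. finite F \<longrightarrow>
      (\<exists>d. right_ideal hull F = right_multiples d) \<and>
      (\<exists>d. left_ideal hull F = left_multiples d))"

definition duo_ring :: "'a::ring_1 itself \<Rightarrow> bool" where
  "duo_ring _ \<longleftrightarrow>
    (\<forall>I :: 'a set. right_ideal I \<or> left_ideal I \<longrightarrow> two_sided_ideal I)"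

definition stable_range_one :: "('b, 'm) ring_scheme \<Rightarrow> bool" where
  "stable_range_one S \<longleftrightarrow>
    (\<forall>a\<in>carrier S. \<forall>b\<in>carrier S.
      (a <#\<^bsub>S\<^esub> carrier S) <+>\<^bsub>S\<^esub> (b <#\<^bsub>S\<^esub> carrier S) = carrier S \<longrightarrow>
      (\<exists>y\<in>carrier S. a \<oplus>\<^bsub>S\<^esub> b \<otimes>\<^bsub>S\<^esub> y \<in> Units S))"

text \<open>
  The next two notions are only meant for duo rings, where \<open>aR\<close> is a two-sided ideal and hence
  \<open>R / aR\<close> is a ring. It is the zero ring if \<open>a\<close> is invertible; then \<open>a\<close> is stable.
\<close>

definition stable_element :: "'a::ring_1 \<Rightarrow> bool" where
  "stable_element a \<longleftrightarrow> stable_range_one ((class_ring :: 'a ring) Quot right_multiples a)"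

definition locally_stable :: "'a::ring_1 itself \<Rightarrow> bool" where
  "locally_stable _ \<longleftrightarrow>
    (\<forall>a b :: 'a. {a * r + b * s | r s. True} = UNIV \<longrightarrow>
      (\<exists>y. stable_element (a + b * y)))"

text \<open>
  \<open>two_sided_ideal hull {d}\<close> is the ideal \<open>RdR\<close> of all finite sums of elements \<open>r * d * s\<close>.
\<close>

definition admits_diagonal_reduction :: "'a::ring_1 mat \<Rightarrow> bool" where
  "admits_diagonal_reduction A \<longleftrightarrow>
    (\<exists>P Q D.
      P \<in> carrier_mat (dim_row A) (dim_row A) \<and> invertible_mat P \<and>
      Q \<in> carrier_mat (dim_col A) (dim_col A) \<and> invertible_mat Q \<and>
      D = P * A * Q \<and> diagonal_mat D \<and>
      (\<forall>i. Suc i < min (dim_row A) (dim_col A) \<longrightarrow>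
        two_sided_ideal hull {D $$ (Suc i, Suc i)}
          \<subseteq> right_multiples (D $$ (i, i)) \<inter> left_multiples (D $$ (i, i))))"

definition elementary_divisor_ring :: "'a::ring_1 itself \<Rightarrow> bool" where
  "elementary_divisor_ring _ \<longleftrightarrow> (\<forall>A :: 'a mat. admits_diagonal_reduction A)"

end

theory Submission
  imports Defs
begin

text \<open>
  The heart of the matter is a triangular matrix with rows \<open>(a, 0)\<close> and \<open>(b, c)\<close> whose entries
  generate the unit ideal. Local stability, applied to \<open>bR + (aR + cR) = R\<close>, allows one to replace
  \<open>b\<close> by a stable element \<open>w\<close>. A column operation turns the row \<open>(w, c)\<close> into \<open>(\<delta>, 0)\<close>, where
  \<open>\<delta>\<close> divides \<open>w\<close>, and the other row into \<open>(\<beta>, \<gamma>)\<close>. Since \<open>R / wR\<close>, and hence \<open>R / \<delta>R\<close>, has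
  stable range 1, some \<open>\<beta> + \<gamma>y\<close> is a unit modulo \<open>\<delta>\<close>, so that the first column becomes unimodular
  and can be reduced to \<open>(1, 0)\<close>. The general case follows by treating the rows one after the other
  until the corner entry divides all entries. In a duo ring left and right multiples of an element
  agree, so divisibility is compatible with row as well as column operations.
\<close>

section \<open>Divisibility in duo rings\<close>

definition rdvd :: "'a::ring_1 \<Rightarrow> 'a \<Rightarrow> bool" (infix \<open>rdvd\<close> 50) where
  "g rdvd a \<longleftrightarrow> (\<exists>k. a = g * k)"

lemma right_multiples_iff: "a \<in> right_multiples g \<longleftrightarrow> g rdvd a"
  by (auto simp: right_multiples_def rdvd_def)

lemma left_multiples_iff: "a \<in> left_multiples g \<longleftrightarrow> (\<exists>r. a = r * g)"
  by (auto simp: left_multiples_def)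

lemma rdvd_mult_right: "g rdvd a \<Longrightarrow> g rdvd a * (r::'a::ring_1)"
  by (metis rdvd_def mult.assoc)

lemma rdvd_add: "g rdvd a \<Longrightarrow> g rdvd b \<Longrightarrow> g rdvd a + (b::'a::ring_1)"
  by (metis rdvd_def distrib_left)

lemma rdvd_zero [simp]: "g rdvd (0::'a::ring_1)"
  by (metis rdvd_def mult_zero_right)

lemma rdvd_refl [simp]: "g rdvd (g::'a::ring_1)"
  by (metis rdvd_def mult_1_right)

lemma rdvd_trans: "a rdvd b \<Longrightarrow> b rdvd c \<Longrightarrow> a rdvd (c::'a::ring_1)"
  by (metis rdvd_def mult.assoc)

lemma rdvd_cancel: "g \<noteq> 0 \<Longrightarrow> g * a rdvd g * b \<longleftrightarrow> a rdvd (b::'a::ring_1_no_zero_divisors)"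
  by (auto simp: rdvd_def mult.assoc)

lemma rdvd_sum: "(\<And>x. x \<in> S \<Longrightarrow> g rdvd f x) \<Longrightarrow> g rdvd (sum f S :: 'a::ring_1)"
  by (induction S rule: infinite_finite_induct) (auto intro: rdvd_add)

lemma right_ideal_right_multiples: "right_ideal (right_multiples a)"
  unfolding right_ideal_def
  by (auto simp: right_multiples_iff intro: rdvd_add rdvd_mult_right)

lemma left_ideal_left_multiples: "left_ideal (left_multiples a)"
  unfolding left_ideal_def
  by (auto simp: left_multiples_def image_iff simp flip: distrib_right mult.assoc
      intro: exI[of _ 0])

text \<open>The right ideal \<open>aR\<close> is two-sided and so contains \<open>r * a\<close>.
  Together with \<open>duo_right_to_left\<close> this replaces commutativity: a factor may pass
  \<open>a\<close> at the price of being changed.\<close>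

lemma duo_left_to_right:
  assumes "duo_ring TYPE('a::ring_1)"
  obtains s where "r * (a::'a) = a * s"
proof -
  have "left_ideal (right_multiples a)"
    using assms right_ideal_right_multiples[of a]
    unfolding duo_ring_def two_sided_ideal_def by blast
  moreover have "a \<in> right_multiples a" by (simp add: right_multiples_iff)
  ultimately have "r * a \<in> right_multiples a" unfolding left_ideal_def by blast
  then show thesis using that by (auto simp: right_multiples_iff rdvd_def)
qed

lemma duo_right_to_left:
  assumes "duo_ring TYPE('a::ring_1)"
  obtains s where "(a::'a) * r = s * a"
proof -
  have "right_ideal (left_multiples a)"
    using assms left_ideal_left_multiples[of a]
    unfolding duo_ring_def two_sided_ideal_def by blast
  moreover have "a \<in> left_multiples a"
    unfolding left_multiples_iff by (metis mult_1_left)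
  ultimately have "a * r \<in> left_multiples a" unfolding right_ideal_def by blast
  then show thesis using that by (auto simp: left_multiples_iff)
qed

lemma duo_rdvd_mult_left:
  assumes "duo_ring TYPE('a::ring_1)" "(g::'a) rdvd a"
  shows "g rdvd r * a"
proof -
  obtain k where "a = g * k" using assms(2) by (auto simp: rdvd_def)
  moreover obtain s where "r * g = g * s" using duo_left_to_right[OF assms(1)] .
  ultimately have "r * a = g * (s * k)" by (metis mult.assoc)
  then show ?thesis by (auto simp: rdvd_def)
qed

lemma duo_multiples_eq:
  assumes "duo_ring TYPE('a::ring_1)"
  shows "left_multiples (a::'a) = right_multiples a"
  unfolding left_multiples_def right_multiples_def
  by (auto simp: image_iff) (metis duo_left_to_right[OF assms], metis duo_right_to_left[OF assms])

section \<open>Unimodular rows and the Hermite property\<close>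

text \<open>The 2-by-2 matrices with rows (p, q), (r, s) and (p', q'), (r', s') are two-sided
  inverses of each other. The equations are written out because entries need not commute and no
  determinant is at hand.\<close>

definition mutually_inverse2 ::
    "'a::ring_1 \<Rightarrow> 'a \<Rightarrow> 'a \<Rightarrow> 'a \<Rightarrow> 'a \<Rightarrow> 'a \<Rightarrow> 'a \<Rightarrow> 'a \<Rightarrow> bool" where
  "mutually_inverse2 p q r s p' q' r' s' \<longleftrightarrow>
    p * p' + q * r' = 1 \<and> p * q' + q * s' = 0 \<and> r * p' + s * r' = 0 \<and> r * q' + s * s' = 1 \<and>
    p' * p + q' * r = 1 \<and> p' * q + q' * s = 0 \<and> r' * p + s' * r = 0 \<and> r' * q + s' * s = 1"

lemma mutually_inverse2_commute:
  "mutually_inverse2 p q r s p' q' r' s' \<Longrightarrow> mutually_inverse2 p' q' r' s' p q r s"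
  by (simp add: mutually_inverse2_def)

text \<open>
  The second column \<open>(b, -t)\<close> of the inverse generates the kernel of \<open>(x, y) \<mapsto> a * x + b * y\<close>,
  because \<open>aR \<inter> bR = abR\<close> for comaximal elements of a duo ring.
\<close>
lemma unimodular_row_completion:
  fixes a b u v :: "'a::ring_1_no_zero_divisors"
  assumes duo: "duo_ring TYPE('a)" and unim: "a * u + b * v = 1"
  obtains x y p q where "mutually_inverse2 a b p q u x v y"
proof (cases "b = 0")
  case True
  then have au: "a * u = 1" using unim by simp
  \<comment> \<open>Cancelling \<open>a\<close> makes its right inverse two-sided, so (a, 0) is the
    first row of an invertible lower triangular matrix. The general case cancels \<open>b\<close>,
    hence the separation.\<close>
  then have "a * (u * a - 1) = 0" by (simp add: algebra_simps flip: mult.assoc)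
  then have ua: "u * a = 1" using au by force
  have "mutually_inverse2 a b (- v * a) 1 u 0 v 1"
    unfolding mutually_inverse2_def using True au ua by (simp add: mult.assoc)
  then show thesis by (rule that)
next
  case b: False
  obtain t where t: "a * b = b * t" using duo_left_to_right[OF duo] .
  obtain u1 where u1: "a * u = u1 * a" using duo_right_to_left[OF duo] .
  obtain v1 where v1: "b * v = v1 * b" using duo_right_to_left[OF duo] .
  have kernel: "\<exists>z. x = b * z \<and> y = - t * z" if k: "a * x + b * y = 0" for x y
  proof -
    \<comment> \<open>With the coefficients of 1 moved to the left, \<open>a * x\<close> appears and
      can be replaced by \<open>- (b * y)\<close>; both summands are then multiples of
      \<open>b\<close>.\<close>
    have "x = (u1 * a + v1 * b) * x" using unim u1 v1 by simp
    also have "\<dots> = u1 * (a * x) + v1 * b * x" by (simp add: algebra_simps)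
    also have "a * x = - (b * y)" using k by (simp add: eq_neg_iff_add_eq_0)
    finally have x: "x = u1 * - (b * y) + v1 * b * x" .
    have "b rdvd u1 * (b * - y) + v1 * (b * x)"
      by (rule rdvd_add[OF duo_rdvd_mult_left[OF duo] duo_rdvd_mult_left[OF duo]])
         (simp_all add: rdvd_mult_right flip: mult_minus_right)
    then have "b rdvd x" using x by (simp add: mult.assoc)
    then obtain z where z: "x = b * z" by (auto simp: rdvd_def)
    have "b * (t * z + y) = 0" using k z t by (simp add: distrib_left flip: mult.assoc)
    then have "y = - t * z" using b by (simp add: eq_neg_iff_add_eq_0 add.commute)
    with z show ?thesis by blast
  qed
  \<comment> \<open>The columns of the identity minus the product of the column (u, v) with the row
    (a, b) lie in the kernel. Their coordinates \<open>p\<close> and \<open>q\<close> with respect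
    to (b, -t) form the missing row.\<close>
  have "a * (1 - u * a) + b * (- v * a) = a - (a * u + b * v) * a" by (simp add: algebra_simps)
  then have "a * (1 - u * a) + b * (- v * a) = 0" using unim by simp
  from kernel[OF this] obtain p where p: "1 - u * a = b * p" "- v * a = - t * p" by blast
  have "a * (- u * b) + b * (1 - v * b) = b - (a * u + b * v) * b" by (simp add: algebra_simps)
  then have "a * (- u * b) + b * (1 - v * b) = 0" using unim by simp
  from kernel[OF this] obtain q where q: "- u * b = b * q" "1 - v * b = - t * q" by blast
  \<comment> \<open>The product in the other order is obtained by cancelling \<open>b\<close> on the
    left.\<close>
  have "b * (p * u + q * v) = (b * p) * u + (b * q) * v" by (simp add: algebra_simps)
  also have "\<dots> = u - u * (a * u + b * v)"
    by (simp only: flip: p(1) q(1)) (simp add: algebra_simps)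
  finally have e1: "p * u + q * v = 0" using unim b by simp
  have "b * (p * b - q * t - 1) = (b * p) * b - (b * q) * t - b" by (simp add: algebra_simps)
  also have "\<dots> = - u * (a * b) + u * (b * t)"
    by (simp only: flip: p(1) q(1)) (simp add: algebra_simps)
  finally have e2: "p * b - q * t = 1" using t b by simp
  have "mutually_inverse2 a b p q u b v (- t)"
    unfolding mutually_inverse2_def
  proof (intro conjI)
    show "u * a + b * p = 1" "u * b + b * q = 0" by (simp_all flip: p(1) q(1))
    show "v * a + - t * p = 0" "v * b + - t * q = 1" by (simp_all only: flip: p(2) q(2)) simp_all
  qed (use unim t e1 e2 in \<open>simp_all add: algebra_simps\<close>)
  then show thesis by (rule that)
qed

lemma bezout_gcd2:
  fixes a b :: "'a::ring_1"
  assumes "bezout_ring TYPE('a)"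
  obtains d u v where "d = a * u + b * v" "d rdvd a" "d rdvd b"
proof -
  obtain d where d: "right_ideal hull {a, b} = right_multiples d"
    using assms unfolding bezout_ring_def by (meson finite.emptyI finite.insertI)
  have ab: "{a, b} \<subseteq> right_ideal hull {a, b}" by (rule hull_subset)
  \<comment> \<open>The right ideal \<open>aR + bR\<close> contains the hull, hence its generator
    \<open>d\<close>.\<close>
  let ?J = "{a * u + b * v | u v. True}"
  have "right_ideal ?J"
    unfolding right_ideal_def
  proof (intro conjI ballI allI)
    show "0 \<in> ?J" by (auto intro!: exI[of _ 0])
  next
    fix x y assume "x \<in> ?J" "y \<in> ?J"
    then obtain u v u' v' where "x = a * u + b * v" "y = a * u' + b * v'" by blast
    then have "x + y = a * (u + u') + b * (v + v')" by (simp add: algebra_simps)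
    then show "x + y \<in> ?J" by blast
  next
    fix x r assume "x \<in> ?J"
    then obtain u v where "x = a * u + b * v" by blast
    then have "x * r = a * (u * r) + b * (v * r)" by (simp add: algebra_simps)
    then show "x * r \<in> ?J" by blast
  qed
  moreover have "a = a * 1 + b * 0" "b = a * 0 + b * 1" by simp_all
  then have "{a, b} \<subseteq> ?J" by blast
  ultimately have "right_ideal hull {a, b} \<subseteq> ?J" by (intro hull_minimal)
  moreover have "d \<in> right_ideal hull {a, b}" unfolding d by (simp add: right_multiples_iff)
  ultimately obtain u v where "d = a * u + b * v" by blast
  moreover have "d rdvd a" "d rdvd b" using ab unfolding d by (simp_all add: right_multiples_iff)
  ultimately show thesis by (rule that)
qed

lemma bezout_gcd3:
  fixes a b c :: "'a::ring_1"
  assumes "bezout_ring TYPE('a)"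
  obtains d u v w where "d = a * u + b * v + c * w" "d rdvd a" "d rdvd b" "d rdvd c"
proof -
  obtain e u v where e: "e = a * u + b * v" "e rdvd a" "e rdvd b"
    using bezout_gcd2[OF assms] .
  obtain d r w where d: "d = e * r + c * w" "d rdvd e" "d rdvd c"
    using bezout_gcd2[OF assms] .
  have "d = a * (u * r) + b * (v * r) + c * w"
    unfolding d(1) e(1) by (simp add: algebra_simps)
  then show thesis using that d e rdvd_trans by blast
qed

text \<open>Divided by its gcd d, the row (a, b) becomes unimodular; the inverse of a completion of
  the quotient row carries (a, b) to (d, 0).\<close>

lemma right_hermite:
  fixes a b :: "'a::ring_1_no_zero_divisors"
  assumes bez: "bezout_ring TYPE('a)" and duo: "duo_ring TYPE('a)"
  obtains p q r s p' q' r' s' where "mutually_inverse2 p q r s p' q' r' s'"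
    "a * q + b * s = 0" "a * p + b * r rdvd a" "a * p + b * r rdvd b"
proof -
  obtain d u v where d: "d = a * u + b * v" "d rdvd a" "d rdvd b"
    using bezout_gcd2[OF bez] .
  show thesis
  proof (cases "d = 0")
    case True
    then have ab: "a = 0" "b = 0" using d by (auto simp: rdvd_def)
    have "mutually_inverse2 1 0 0 1 1 0 0 (1::'a)" by (simp add: mutually_inverse2_def)
    then show thesis by (rule that) (simp_all add: ab)
  next
    case False
    obtain a' where a': "a = d * a'" using d(2) unfolding rdvd_def ..
    obtain b' where b': "b = d * b'" using d(3) unfolding rdvd_def ..
    have "d * (a' * u + b' * v - 1) = 0"
      using d(1) unfolding a' b' by (simp add: algebra_simps)
    then have "a' * u + b' * v = 1" using False by simp
    from unimodular_row_completion[OF duo this]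
    obtain x y p q where i: "mutually_inverse2 a' b' p q u x v y" .
    have "a * x + b * y = d * (a' * x + b' * y)"
      unfolding a' b' by (simp add: algebra_simps)
    then have 0: "a * x + b * y = 0" using i by (simp add: mutually_inverse2_def)
    show thesis
      by (rule that[OF mutually_inverse2_commute[OF i] 0]) (use d in auto)
  qed
qed

text \<open>Only the row is recorded: by \<open>unimodular_row_completion\<close> it extends to an invertible matrix.\<close>
lemma left_gcd_row:
  fixes a b :: "'a::ring_1_no_zero_divisors"
  assumes bez: "bezout_ring TYPE('a)" and duo: "duo_ring TYPE('a)"
  obtains p q k l where "p * k + q * l = 1" "p * a + q * b rdvd a" "p * a + q * b rdvd b"
proof -
  obtain d u v where d: "d = a * u + b * v" "d rdvd a" "d rdvd b"
    using bezout_gcd2[OF bez] .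
  show thesis
  proof (cases "d = 0")
    case True
    then have ab: "a = 0" "b = 0" using d by (auto simp: rdvd_def)
    show thesis by (rule that[of 1 1 0 0]) (simp_all add: ab)
  next
    case False
    \<comment> \<open>All coefficients are moved to the other side of \<open>a\<close>,
      \<open>b\<close> and \<open>d\<close>, so that \<open>d\<close> can be cancelled on the right
      and (p, q) is seen to be unimodular.\<close>
    obtain p where p: "a * u = p * a" using duo_right_to_left[OF duo] .
    obtain q where q: "b * v = q * b" using duo_right_to_left[OF duo] .
    obtain k where k: "a = k * d" using d(2) unfolding rdvd_def by (metis duo_right_to_left[OF duo])
    obtain l where l: "b = l * d" using d(3) unfolding rdvd_def by (metis duo_right_to_left[OF duo])
    have dpq: "d = p * a + q * b" using d p q by simp
    then have "d = p * (k * d) + q * (l * d)" unfolding k[symmetric] l[symmetric] .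
    then have "(p * k + q * l - 1) * d = 0" by (simp add: algebra_simps)
    then have "p * k + q * l = 1" using False by simp
    then show thesis by (rule that) (use d dpq in auto)
  qed
qed

section \<open>Stable elements\<close>

lemma right_multiples_ideal:
  assumes "duo_ring TYPE('a::ring_1)"
  shows "ideal (right_multiples (w::'a)) (class_ring :: 'a ring)"
proof -
  have l: "left_ideal (right_multiples w)" and r: "right_ideal (right_multiples w)"
    using assms right_ideal_right_multiples[of w]
    unfolding duo_ring_def two_sided_ideal_def by blast+
  let ?G = "add_monoid (class_ring :: 'a ring)"
  interpret G: Group.group ?G
    by (rule abelian_group.a_group[OF ring.is_abelian_group[OF class_ring.ring_axioms]])
  have "inv\<^bsub>?G\<^esub> x = - x" for x
    by (rule G.inv_equality) auto
  moreover have "- x \<in> right_multiples w" if "x \<in> right_multiples w" for x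
    using l that unfolding left_ideal_def by (metis mult_minus1)
  ultimately have "subgroup (right_multiples w) ?G"
    using r by (intro G.subgroupI) (auto simp: right_ideal_def)
  then show ?thesis
    using l r by (intro idealI class_ring.ring_axioms) (auto simp: left_ideal_def right_ideal_def)
qed

text \<open>Translates stable range 1 of \<open>R / wR\<close> into equations in \<open>R\<close>.
  The images of \<open>a\<close> and \<open>b\<close> generate the quotient because
  \<open>w * t\<close> vanishes there; the unit lifts to \<open>a + b * y\<close>, and
  \<open>z\<close> lifts its inverse.\<close>

lemma stable_element_unit:
  fixes a b c w :: "'a::ring_1"
  assumes duo: "duo_ring TYPE('a)" and st: "stable_element w"
    and unim: "a * r + b * s + w * t = 1"
  obtains y z k where "(a + b * y) * z + w * k = 1"
proof -
  let ?R = "class_ring :: 'a ring"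
  let ?I = "right_multiples w"
  let ?S = "?R Quot ?I"
  let ?h = "\<lambda>x::'a. ?I +>\<^bsub>?R\<^esub> x"
  interpret I: ideal ?I ?R by (rule right_multiples_ideal[OF duo])
  have hom: "?h \<in> Ring.ring_hom ?R ?S" by (rule I.rcos_ring_hom)
  have hc: "?h x \<in> carrier ?S" for x using ring_hom_closed[OF hom] by simp
  have hm: "?h (x * y) = ?h x \<otimes>\<^bsub>?S\<^esub> ?h y" for x y using ring_hom_mult[OF hom] by simp
  have ha: "?h (x + y) = ?h x \<oplus>\<^bsub>?S\<^esub> ?h y" for x y using ring_hom_add[OF hom] by simp
  have h1: "?h 1 = \<one>\<^bsub>?S\<^esub>" using ring_hom_one[OF hom] by simp
  have hs: "\<exists>x. X = ?h x" if "X \<in> carrier ?S" for X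
    using that by (auto simp: FactRing_def A_RCOSETS_def' a_r_coset_def)
  have heq: "?h x = ?h y \<longleftrightarrow> w rdvd x - y" for x y
    using ring.quotient_eq_iff_same_a_r_cos[OF class_ring.ring_axioms right_multiples_ideal[OF duo], of x y]
    by (simp add: class_ring_simps right_multiples_iff)
  interpret S: ring ?S by (rule I.quotient_is_ring)
  have "(?h a <#\<^bsub>?S\<^esub> carrier ?S) <+>\<^bsub>?S\<^esub> (?h b <#\<^bsub>?S\<^esub> carrier ?S) = carrier ?S" (is "?L = _")
  proof (intro equalityI subsetI)
    fix X assume "X \<in> ?L"
    then show "X \<in> carrier ?S"
      using hc[of a] hc[of b] by (auto simp: set_add_def' l_coset_def)
  next
    fix X assume "X \<in> carrier ?S"
    then obtain x where X: "X = ?h x" using hs by blast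
    have "w rdvd x - (a * (r * x) + b * (s * x))"
    proof -
      have "x - (a * (r * x) + b * (s * x)) = (a * r + b * s + w * t) * x - (a * r + b * s) * x"
        unfolding unim by (simp add: algebra_simps)
      also have "\<dots> = w * (t * x)" by (simp add: algebra_simps)
      finally show ?thesis by (auto simp: rdvd_def)
    qed
    then have "X = ?h (a * (r * x) + b * (s * x))" unfolding X heq .
    then have "X = (?h a \<otimes>\<^bsub>?S\<^esub> ?h (r * x)) \<oplus>\<^bsub>?S\<^esub> (?h b \<otimes>\<^bsub>?S\<^esub> ?h (s * x))"
      by (simp only: ha hm)
    then show "X \<in> ?L" unfolding set_add_def' l_coset_def using hc by blast
  qed
  then obtain Y where Y: "Y \<in> carrier ?S" "?h a \<oplus>\<^bsub>?S\<^esub> ?h b \<otimes>\<^bsub>?S\<^esub> Y \<in> Units ?S"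
    using st hc unfolding stable_element_def stable_range_one_def by blast
  then obtain y where y: "Y = ?h y" using hs by blast
  from Y(2) obtain Z where Z: "Z \<in> carrier ?S" "(?h a \<oplus>\<^bsub>?S\<^esub> ?h b \<otimes>\<^bsub>?S\<^esub> Y) \<otimes>\<^bsub>?S\<^esub> Z = \<one>\<^bsub>?S\<^esub>"
    unfolding Units_def by blast
  then obtain z where z: "Z = ?h z" using hs by blast
  have "?h ((a + b * y) * z) = ?h 1" using Z(2) unfolding y z by (simp only: ha hm h1)
  then have "w rdvd 1 - (a + b * y) * z" using heq by metis
  then obtain k where "1 - (a + b * y) * z = w * k" by (auto simp: rdvd_def)
  then have "(a + b * y) * z + w * k = 1" by (metis diff_add_cancel add.commute)
  then show thesis by (rule that)
qed

section \<open>Reduction of a triangular 2-by-2 block\<close>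

text \<open>Here \<open>d\<close> is the row (p, q) times the matrix with rows (a, 0), (b, c) times
  the column (x, z). Row and column are unimodular, so they extend to invertible matrices and
  \<open>d\<close> becomes the corner of an equivalent matrix.\<close>

lemma triangular_reduction:
  fixes a b c :: "'a::ring_1_no_zero_divisors"
  assumes bez: "bezout_ring TYPE('a)" and duo: "duo_ring TYPE('a)"
    and ls: "locally_stable TYPE('a)"
  obtains p q k l x z m n d
  where "p * k + q * l = 1" "m * x + n * z = 1" "d = p * (a * x) + q * (b * x + c * z)"
    "d rdvd a" "d rdvd b" "d rdvd c"
proof -
  obtain g ka kb kc where g: "g = a * ka + b * kb + c * kc" and ga: "g rdvd a" and gb: "g rdvd b"
    and gc: "g rdvd c" using bezout_gcd3[OF bez] .
  show thesis
  proof (cases "g = 0")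
    case True
    then have abc: "a = 0" "b = 0" "c = 0" using ga gb gc by (auto simp: rdvd_def)
    show thesis by (rule that[of 1 1 0 0 1 1 0 0 0]) (simp_all add: abc)
  next
    case g0: False
    obtain a' where a': "a = g * a'" using ga by (auto simp: rdvd_def)
    obtain b' where b': "b = g * b'" using gb by (auto simp: rdvd_def)
    obtain c' where c': "c = g * c'" using gc by (auto simp: rdvd_def)
    have "g * (a' * ka + b' * kb + c' * kc - 1) = 0"
      using g unfolding a' b' c' by (simp add: algebra_simps)
    then have one: "a' * ka + b' * kb + c' * kc = 1" using g0 by simp
    have "{b' * r + (a' * ka + c' * kc) * s | r s. True} = UNIV"
    proof -
      have "b' * (kb * x) + (a' * ka + c' * kc) * x = x" for x
      proof -
        have "b' * (kb * x) + (a' * ka + c' * kc) * x = (a' * ka + b' * kb + c' * kc) * x"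
          by (simp add: algebra_simps)
        then show ?thesis by (simp add: one)
      qed
      then have "\<exists>r s. x = b' * r + (a' * ka + c' * kc) * s" for x by metis
      then show ?thesis by blast
    qed
    then obtain t where st: "stable_element (b' + (a' * ka + c' * kc) * t)"
      using ls unfolding locally_stable_def by blast
    define w' where "w' = b' + (a' * ka + c' * kc) * t"
    \<comment> \<open>The summand \<open>a * (ka * t)\<close> cannot reach \<open>b\<close> by a
      column operation, as \<open>a\<close> lies in another row. Rewritten as \<open>s * a\<close>
      it comes from adding \<open>s\<close> times the first row to the second, whereas
      \<open>c * (kc * t)\<close> comes from adding a multiple of the second column to the
      first.\<close>
    obtain s where s: "a * (ka * t) = s * a" using duo_right_to_left[OF duo] .
    define w where "w = b + s * a + c * (kc * t)"
    have w: "w = g * w'"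
      unfolding w_def w'_def s[symmetric] unfolding a' b' c' by (simp add: algebra_simps)
    \<comment> \<open>This column operation turns the row (w, c) into (g \<delta>, 0) and the row
      (a, 0) into (g \<beta>, g \<gamma>).\<close>
    obtain x1 x2 z1 z2 y1 y2 y3 y4 where inv: "mutually_inverse2 x1 x2 z1 z2 y1 y2 y3 y4"
      and zero: "w * x2 + c * z2 = 0"
      and dw: "w * x1 + c * z1 rdvd w" and dc: "w * x1 + c * z1 rdvd c"
      using right_hermite[OF bez duo] .
    define \<delta> where "\<delta> = w' * x1 + c' * z1"
    have g\<delta>: "w * x1 + c * z1 = g * \<delta>" unfolding \<delta>_def w c' by (simp add: algebra_simps)
    obtain h1 where h1: "w' = \<delta> * h1"
      using dw unfolding g\<delta> unfolding w rdvd_cancel[OF g0] by (auto simp: rdvd_def)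
    obtain h2 where h2: "c' = \<delta> * h2"
      using dc unfolding g\<delta> unfolding c' rdvd_cancel[OF g0] by (auto simp: rdvd_def)
    define \<beta> \<gamma> where "\<beta> = a' * x1" and "\<gamma> = a' * x2"
    have a'': "a' = \<beta> * y1 + \<gamma> * y3"
    proof -
      have "\<beta> * y1 + \<gamma> * y3 = a' * (x1 * y1 + x2 * y3)"
        unfolding \<beta>_def \<gamma>_def by (simp add: algebra_simps)
      then show ?thesis using inv by (simp add: mutually_inverse2_def)
    qed
    \<comment> \<open>Substituting \<open>b' = w' - (a' * ka + c' * kc) * t\<close> into
      \<open>one\<close> and collecting the multiples of \<delta> gives
      \<open>a' * e + \<delta> * f = 1\<close>.\<close>
    define e where "e = ka - ka * t * kb"
    define f where "f = h1 * kb + h2 * (kc - kc * t * kb)"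
    have "\<beta> * (y1 * e) + (\<gamma> * (y3 * e) + \<delta> * f) * 1 + w' * 0 = a' * e + \<delta> * f"
      unfolding a'' by (simp add: algebra_simps)
    also have "\<dots> = a' * e + w' * kb + c' * (kc - kc * t * kb)"
      unfolding f_def distrib_left h1 h2 by (simp only: mult.assoc add.assoc)
    also have "\<dots> = a' * ka + b' * kb + c' * kc"
      unfolding e_def w'_def by (simp add: algebra_simps)
    finally have "\<beta> * (y1 * e) + (\<gamma> * (y3 * e) + \<delta> * f) * 1 + w' * 0 = 1" using one by simp
    \<comment> \<open>Stable range 1 is used modulo \<open>w'\<close> itself; adding
      \<open>\<delta> * f\<close> to the second generator makes the pair comaximal there. Since
      \<delta> divides \<open>w'\<close>, the result is also a unit modulo \<delta>, where it is
      congruent to \<open>\<beta> + \<gamma> * \<eta>\<close>.\<close>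
    from stable_element_unit[OF duo st[folded w'_def] this] obtain y z k where
      yz: "(\<beta> + (\<gamma> * (y3 * e) + \<delta> * f) * y) * z + w' * k = 1" .
    define \<eta> where "\<eta> = y3 * e * y"
    \<comment> \<open>The second new column times \<eta> is added to the first. In \<open>z'\<close>
      the term \<open>kc * t * x\<close> expresses the column operation hidden in \<open>w\<close>
      in terms of the original columns.\<close>
    define x where "x = x1 + x2 * \<eta>"
    define z' where "z' = kc * t * x + (z1 + z2 * \<eta>)"
    have "a' * x * z + \<delta> * (f * y * z + h1 * k)
        = (\<beta> + (\<gamma> * (y3 * e) + \<delta> * f) * y) * z + \<delta> * h1 * k"
      unfolding x_def \<eta>_def \<beta>_def \<gamma>_def by (simp add: algebra_simps)
    then have unit: "a' * x * z + \<delta> * (f * y * z + h1 * k) = 1"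
      using yz unfolding h1 by simp
    have col: "s * (a * x) + b * x + c * z' = g * \<delta>"
    proof -
      have "s * (a * x) + b * x + c * z' = w * x + c * (z1 + z2 * \<eta>)"
        unfolding w_def z'_def by (simp add: algebra_simps)
      also have "\<dots> = w * x1 + c * z1 + (w * x2 + c * z2) * \<eta>"
        unfolding x_def by (simp add: algebra_simps)
      finally show ?thesis using zero g\<delta> by simp
    qed
    obtain p q k' l' where pq: "p * k' + q * l' = 1" and
      d1: "p * (a * x) + q * (g * \<delta>) rdvd a * x" and d2: "p * (a * x) + q * (g * \<delta>) rdvd g * \<delta>"
      using left_gcd_row[OF bez duo] .
    define d where "d = p * (a * x) + q * (g * \<delta>)"
    \<comment> \<open>Thus \<open>g\<close> lies in the right ideal generated by the column entries
      \<open>a * x\<close> and \<open>g * \<delta>\<close>; their gcd \<open>d\<close> divides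
      \<open>g\<close> and hence \<open>a\<close>, \<open>b\<close>, \<open>c\<close>.\<close>
    have "g = a * x * z + g * \<delta> * (f * y * z + h1 * k)"
    proof -
      have "a * x * z + g * \<delta> * (f * y * z + h1 * k) = g * (a' * x * z + \<delta> * (f * y * z + h1 * k))"
        unfolding a' by (simp only: distrib_left mult.assoc)
      then show ?thesis using unit by simp
    qed
    then have dg: "d rdvd g"
      using d1 d2 unfolding d_def by (metis rdvd_add rdvd_mult_right)
    show thesis
    proof (rule that)
      \<comment> \<open>The row (p, q) acts after \<open>s\<close> times the first row has been
        added to the second, which turns it into (p + q s, q).\<close>
      show "(p + q * s) * k' + q * (l' - s * k') = 1" using pq by (simp add: algebra_simps)
      \<comment> \<open>The row (y1, y2) of the inverse sends (x1, z1) to 1 and kills (x2,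
        z2).\<close>
      have "(y1 - y2 * kc * t) * x + y2 * z' = y1 * x + y2 * (z1 + z2 * \<eta>)"
        unfolding z'_def by (simp add: algebra_simps)
      also have "\<dots> = (y1 * x1 + y2 * z1) + (y1 * x2 + y2 * z2) * \<eta>"
        unfolding x_def by (simp add: algebra_simps)
      finally show "(y1 - y2 * kc * t) * x + y2 * z' = 1"
        using inv by (simp add: mutually_inverse2_def)
      show "d = (p + q * s) * (a * x) + q * (b * x + c * z')"
        unfolding d_def col[symmetric] by (simp add: algebra_simps)
      show "d rdvd a" "d rdvd b" "d rdvd c" using dg ga gb gc rdvd_trans by blast+
    qed
  qed
qed

section \<open>Equivalence of matrices\<close>

lemma invertible_mat_mult:
  assumes "P \<in> carrier_mat n n" "P' \<in> carrier_mat n n" "invertible_mat P" "invertible_mat P'"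
  shows "invertible_mat (P * P' :: 'a::semiring_1 mat)"
proof -
  from assms(1,3) obtain R where R: "P * R = 1\<^sub>m n" "R * P = 1\<^sub>m (dim_row R)"
    unfolding invertible_mat_def inverts_mat_def by auto
  \<comment> \<open>The size of \<open>R\<close> is read off from the dimensions of the two identity
    matrices.\<close>
  have Rc: "R \<in> carrier_mat n n"
    using arg_cong[OF R(1), of dim_col] arg_cong[OF R(2), of dim_col] assms(1) by auto
  from assms(2,4) obtain R' where R': "P' * R' = 1\<^sub>m n" "R' * P' = 1\<^sub>m (dim_row R')"
    unfolding invertible_mat_def inverts_mat_def by auto
  have Rc': "R' \<in> carrier_mat n n"
    using arg_cong[OF R'(1), of dim_col] arg_cong[OF R'(2), of dim_col] assms(2) by auto
  have "P * P' * (R' * R) = P * (P' * R') * R"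
    using assms(1,2) Rc Rc' by (simp add: assoc_mult_mat[of _ n n _ n _ n])
  then have 1: "P * P' * (R' * R) = 1\<^sub>m n" using R R' assms(1) by simp
  have "R' * R * (P * P') = R' * (R * P) * P'"
    using assms(1,2) Rc Rc' by (simp add: assoc_mult_mat[of _ n n _ n _ n])
  then have 2: "R' * R * (P * P') = 1\<^sub>m n" using R R' Rc Rc' by simp
  show ?thesis
    unfolding invertible_mat_def inverts_mat_def
    using 1 2 assms(1,2) Rc Rc' by (auto intro!: exI[of _ "R' * R"])
qed

lemma invertible_matI:
  assumes "P \<in> carrier_mat n n" "R \<in> carrier_mat n n" "P * R = 1\<^sub>m n" "R * P = 1\<^sub>m n"
  shows "invertible_mat P"
  unfolding invertible_mat_def inverts_mat_def using assms by auto

lemma invertible_mat_inverse: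
  assumes "P \<in> carrier_mat n n" "invertible_mat P"
  obtains R where "R \<in> carrier_mat n n" "P * R = 1\<^sub>m n" "R * P = 1\<^sub>m n"
proof -
  from assms obtain R where R: "P * R = 1\<^sub>m n" "R * P = 1\<^sub>m (dim_row R)"
    unfolding invertible_mat_def inverts_mat_def by auto
  have "R \<in> carrier_mat n n"
    using arg_cong[OF R(1), of dim_col] arg_cong[OF R(2), of dim_col] assms(1) by auto
  with R show thesis by (intro that) auto
qed

lemma invertible_mat_one: "invertible_mat (1\<^sub>m n :: 'a::semiring_1 mat)"
  by (rule invertible_matI[of _ n "1\<^sub>m n"]) auto

definition mat_equiv :: "'a::semiring_1 mat \<Rightarrow> 'a mat \<Rightarrow> bool" where
  "mat_equiv A B \<longleftrightarrow> (\<exists>P Q.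
    P \<in> carrier_mat (dim_row A) (dim_row A) \<and> invertible_mat P \<and>
    Q \<in> carrier_mat (dim_col A) (dim_col A) \<and> invertible_mat Q \<and> B = P * A * Q)"

lemma mat_equivI:
  assumes "A \<in> carrier_mat m n" "P \<in> carrier_mat m m" "invertible_mat P"
    "Q \<in> carrier_mat n n" "invertible_mat Q" "B = P * A * Q"
  shows "mat_equiv A B"
  unfolding mat_equiv_def carrier_matD[OF assms(1)] using assms(2-) by blast

lemma mat_equivE:
  assumes "mat_equiv A B" "A \<in> carrier_mat m n"
  obtains P Q where "P \<in> carrier_mat m m" "invertible_mat P"
    "Q \<in> carrier_mat n n" "invertible_mat Q" "B = P * A * Q"
  using assms(1) that unfolding mat_equiv_def carrier_matD[OF assms(2)] by blast

lemma mat_equiv_carrier: "mat_equiv A B \<Longrightarrow> A \<in> carrier_mat m n \<Longrightarrow> B \<in> carrier_mat m n"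
  by (auto elim!: mat_equivE)

lemma mat_equiv_refl: "mat_equiv A A"
  by (rule mat_equivI[of A "dim_row A" "dim_col A" "1\<^sub>m (dim_row A)" "1\<^sub>m (dim_col A)"])
     (auto simp: invertible_mat_one)

lemma mat_equiv_trans:
  assumes "mat_equiv A B" "mat_equiv B C"
  shows "mat_equiv A C"
proof -
  define m n where "m = dim_row A" and "n = dim_col A"
  have A: "A \<in> carrier_mat m n" unfolding m_def n_def by simp
  from mat_equivE[OF assms(1) A] obtain P Q where PQ: "P \<in> carrier_mat m m" "invertible_mat P"
    "Q \<in> carrier_mat n n" "invertible_mat Q" "B = P * A * Q" .
  from mat_equivE[OF assms(2) mat_equiv_carrier[OF assms(1) A]]
  obtain P' Q' where PQ': "P' \<in> carrier_mat m m" "invertible_mat P'"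
    "Q' \<in> carrier_mat n n" "invertible_mat Q'" "C = P' * B * Q'" .
  have "C = P' * P * A * (Q * Q')"
    unfolding PQ(5) PQ'(5) using A PQ PQ'
    by (simp add: assoc_mult_mat[of _ m m _ n _ n] assoc_mult_mat[of _ m m _ m _ n]
        assoc_mult_mat[of _ m n _ n _ n] mult_carrier_mat[of _ m n _ n]
        mult_carrier_mat[of _ n n _ n] mult_carrier_mat[of _ m m _ n])
  then show ?thesis
    using A PQ PQ' invertible_mat_mult[of P' m P] invertible_mat_mult[of Q n Q']
    by (intro mat_equivI[of A m n "P' * P" "Q * Q'"]) auto
qed

section \<open>Row and column operations on two indices\<close>

text \<open>For distinct \<open>i\<close>, \<open>j\<close> this is the identity matrix with the
  block (p, q), (r, s) put into rows and columns \<open>i\<close> and \<open>j\<close>.\<close>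

definition pair_mat :: "nat \<Rightarrow> nat \<Rightarrow> nat \<Rightarrow> 'a \<Rightarrow> 'a \<Rightarrow> 'a \<Rightarrow> 'a \<Rightarrow> 'a::ring_1 mat" where
  "pair_mat n i j p q r s = mat n n (\<lambda>(k, l).
    if k = i then (if l = i then p else if l = j then q else 0)
    else if k = j then (if l = i then r else if l = j then s else 0)
    else if k = l then 1 else 0)"

definition row_comb :: "nat \<Rightarrow> nat \<Rightarrow> 'a \<Rightarrow> 'a \<Rightarrow> 'a \<Rightarrow> 'a \<Rightarrow> 'a mat \<Rightarrow> 'a::ring_1 mat" where
  "row_comb i j p q r s A = mat (dim_row A) (dim_col A) (\<lambda>(k, l).
    if k = i then p * A $$ (i, l) + q * A $$ (j, l)
    else if k = j then r * A $$ (i, l) + s * A $$ (j, l)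
    else A $$ (k, l))"

definition col_comb :: "nat \<Rightarrow> nat \<Rightarrow> 'a \<Rightarrow> 'a \<Rightarrow> 'a \<Rightarrow> 'a \<Rightarrow> 'a mat \<Rightarrow> 'a::ring_1 mat" where
  "col_comb i j p q r s A = mat (dim_row A) (dim_col A) (\<lambda>(k, l).
    if l = i then A $$ (k, i) * p + A $$ (k, j) * r
    else if l = j then A $$ (k, i) * q + A $$ (k, j) * s
    else A $$ (k, l))"

lemma pair_mat_carrier [simp]: "pair_mat n i j p q r s \<in> carrier_mat n n"
  by (simp add: pair_mat_def)

lemma sum_two_terms:
  fixes f :: "nat \<Rightarrow> 'a::comm_monoid_add"
  assumes "i < n" "j < n" "i \<noteq> j" "\<And>k. k < n \<Longrightarrow> k \<noteq> i \<Longrightarrow> k \<noteq> j \<Longrightarrow> f k = 0"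
  shows "sum f {0..<n} = f i + f j"
proof -
  have "sum f {0..<n} = sum f {i, j}"
    by (rule sum.mono_neutral_right) (use assms in auto)
  then show ?thesis using assms(3) by simp
qed

lemma sum_one_term:
  fixes f :: "nat \<Rightarrow> 'a::comm_monoid_add"
  assumes "i < n" "\<And>k. k < n \<Longrightarrow> k \<noteq> i \<Longrightarrow> f k = 0"
  shows "sum f {0..<n} = f i"
proof -
  have "sum f {0..<n} = sum f {i}"
    by (rule sum.mono_neutral_right) (use assms in auto)
  then show ?thesis by simp
qed

lemma pair_mat_mult_left:
  assumes "A \<in> carrier_mat m n" "i < m" "j < m" "i \<noteq> j"
  shows "pair_mat m i j p q r s * A = row_comb i j p q r s A" (is "?E * A = _")
proof (rule eq_matI)
  fix k l assume "k < dim_row (row_comb i j p q r s A)" "l < dim_col (row_comb i j p q r s A)"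
  then have kl: "k < m" "l < n" using assms by (auto simp: row_comb_def)
  have e: "(?E * A) $$ (k, l) = (\<Sum>x\<in>{0..<m}. ?E $$ (k, x) * A $$ (x, l))"
    using kl assms by (simp add: scalar_prod_def pair_mat_def)
  show "(?E * A) $$ (k, l) = row_comb i j p q r s A $$ (k, l)"
  proof (cases "k = i \<or> k = j")
    case True
    have "(?E * A) $$ (k, l) = ?E $$ (k, i) * A $$ (i, l) + ?E $$ (k, j) * A $$ (j, l)"
      unfolding e by (rule sum_two_terms) (use True kl assms in \<open>auto simp: pair_mat_def\<close>)
    then show ?thesis using True kl assms by (auto simp: row_comb_def pair_mat_def)
  next
    case False
    have "(?E * A) $$ (k, l) = ?E $$ (k, k) * A $$ (k, l)"
      unfolding e by (rule sum_one_term) (use False kl assms in \<open>auto simp: pair_mat_def\<close>)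
    then show ?thesis using False kl assms by (auto simp: row_comb_def pair_mat_def)
  qed
qed (use assms in \<open>auto simp: row_comb_def pair_mat_def\<close>)

lemma pair_mat_mult_right:
  assumes "A \<in> carrier_mat m n" "i < n" "j < n" "i \<noteq> j"
  shows "A * pair_mat n i j p q r s = col_comb i j p q r s A" (is "A * ?E = _")
proof (rule eq_matI)
  fix k l assume "k < dim_row (col_comb i j p q r s A)" "l < dim_col (col_comb i j p q r s A)"
  then have kl: "k < m" "l < n" using assms by (auto simp: col_comb_def)
  have e: "(A * ?E) $$ (k, l) = (\<Sum>x\<in>{0..<n}. A $$ (k, x) * ?E $$ (x, l))"
    using kl assms by (simp add: scalar_prod_def pair_mat_def)
  show "(A * ?E) $$ (k, l) = col_comb i j p q r s A $$ (k, l)"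
  proof (cases "l = i \<or> l = j")
    case True
    have "(A * ?E) $$ (k, l) = A $$ (k, i) * ?E $$ (i, l) + A $$ (k, j) * ?E $$ (j, l)"
      unfolding e by (rule sum_two_terms) (use True kl assms in \<open>auto simp: pair_mat_def\<close>)
    then show ?thesis using True kl assms by (auto simp: col_comb_def pair_mat_def)
  next
    case False
    have "(A * ?E) $$ (k, l) = A $$ (k, l) * ?E $$ (l, l)"
      unfolding e by (rule sum_one_term) (use False kl assms in \<open>auto simp: pair_mat_def\<close>)
    then show ?thesis using False kl assms by (auto simp: col_comb_def pair_mat_def)
  qed
qed (use assms in \<open>auto simp: col_comb_def pair_mat_def\<close>)

lemma invertible_pair_mat:
  assumes "mutually_inverse2 p q r s p' q' r' s'" "i < n" "j < n" "i \<noteq> j"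
  shows "invertible_mat (pair_mat n i j p q r s)"
proof -
  have *: "pair_mat n i j p q r s * pair_mat n i j p' q' r' s' = 1\<^sub>m n"
    if "mutually_inverse2 p q r s p' q' r' s'" for p q r s p' q' r' s' :: 'a
    unfolding pair_mat_mult_left[OF pair_mat_carrier assms(2-4)]
    by (rule eq_matI)
       (use that assms in \<open>auto simp: row_comb_def pair_mat_def mutually_inverse2_def\<close>)
  show ?thesis
    by (rule invertible_matI[OF pair_mat_carrier pair_mat_carrier
          *[OF assms(1)] *[OF mutually_inverse2_commute[OF assms(1)]]])
qed

lemma mat_equiv_row_comb:
  assumes "mutually_inverse2 p q r s p' q' r' s'" "i < dim_row A" "j < dim_row A" "i \<noteq> j"
  shows "mat_equiv A (row_comb i j p q r s A)"
proof (rule mat_equivI)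
  show "A \<in> carrier_mat (dim_row A) (dim_col A)" by simp
  show "row_comb i j p q r s A = pair_mat (dim_row A) i j p q r s * A * 1\<^sub>m (dim_col A)"
    using pair_mat_mult_left[OF _ assms(2-4), of A "dim_col A"]
    by (simp add: row_comb_def)
qed (use assms in \<open>auto intro: invertible_pair_mat invertible_mat_one\<close>)

lemma mat_equiv_col_comb:
  assumes "mutually_inverse2 p q r s p' q' r' s'" "i < dim_col A" "j < dim_col A" "i \<noteq> j"
  shows "mat_equiv A (col_comb i j p q r s A)"
proof (rule mat_equivI)
  show "A \<in> carrier_mat (dim_row A) (dim_col A)" by simp
  show "col_comb i j p q r s A = 1\<^sub>m (dim_row A) * A * pair_mat (dim_col A) i j p q r s"
    using pair_mat_mult_right[OF _ assms(2-4), of A "dim_row A"]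
    by (simp add: left_mult_one_mat[of A "dim_row A" "dim_col A"])
qed (use assms in \<open>auto intro: invertible_pair_mat invertible_mat_one\<close>)

text \<open>The case \<open>g = 0\<close> of the last clause says that rows which vanish from column \<open>k\<close> on stay so.\<close>
definition col_equiv_from :: "nat \<Rightarrow> 'a::ring_1 mat \<Rightarrow> 'a mat \<Rightarrow> bool" where
  "col_equiv_from k A B \<longleftrightarrow> mat_equiv A B \<and>
    (\<forall>i<dim_row A. \<forall>l<dim_col A. l < k \<longrightarrow> B $$ (i, l) = A $$ (i, l)) \<and>
    (\<forall>i<dim_row A. \<forall>g. (\<forall>l<dim_col A. k \<le> l \<longrightarrow> g rdvd A $$ (i, l)) \<longrightarrow>
      (\<forall>l<dim_col A. k \<le> l \<longrightarrow> g rdvd B $$ (i, l)))"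

lemma col_equiv_from_refl: "col_equiv_from k A A"
  by (simp add: col_equiv_from_def mat_equiv_refl)

lemma col_equiv_from_dims:
  assumes "col_equiv_from k A B"
  shows "dim_row B = dim_row A" "dim_col B = dim_col A"
  using assms mat_equiv_carrier[of A B "dim_row A" "dim_col A"]
  by (auto simp: col_equiv_from_def)

lemma col_equiv_from_trans:
  assumes "col_equiv_from k A B" "col_equiv_from k B C"
  shows "col_equiv_from k A C"
  using assms col_equiv_from_dims[OF assms(1)] mat_equiv_trans[of A B C]
  unfolding col_equiv_from_def by auto

lemma col_equiv_from_col_comb:
  assumes "mutually_inverse2 p q r s p' q' r' s'" "i < dim_col A" "j < dim_col A" "i \<noteq> j"
    "k \<le> i" "k \<le> j"
  shows "col_equiv_from k A (col_comb i j p q r s A)"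
  unfolding col_equiv_from_def
  using mat_equiv_col_comb[OF assms(1-4)] assms(2-)
  by (auto simp: col_comb_def intro!: rdvd_add rdvd_mult_right)

section \<open>Making the corner entry divide all entries\<close>

text \<open>Column \<open>k\<close> is paired with each later column in turn;
  \<open>right_hermite\<close> puts a gcd of the two entries of row \<open>i\<close> into column
  \<open>k\<close> and 0 into the other.\<close>

lemma clear_row_right_of:
  fixes A :: "'a::ring_1_no_zero_divisors mat"
  assumes bez: "bezout_ring TYPE('a)" and duo: "duo_ring TYPE('a)"
    and i: "i < dim_row A" and k: "k < dim_col A"
  obtains B where "col_equiv_from k A B" "B $$ (i, k) rdvd A $$ (i, k)"
    "\<And>l. k < l \<Longrightarrow> l < dim_col A \<Longrightarrow> B $$ (i, l) = 0"
proof -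
  \<comment> \<open>After \<open>d\<close> steps the next column to clear is
    \<open>Suc k + d\<close>; at \<open>d = dim_col A - Suc k\<close> the row is finished.\<close>
  have "\<exists>B. col_equiv_from k A B \<and> B $$ (i, k) rdvd A $$ (i, k) \<and>
    (\<forall>l. k < l \<and> l < Suc k + d \<longrightarrow> B $$ (i, l) = 0)" if "k + d < dim_col A" for d
    using that
  proof (induction d)
    case 0
    show ?case using col_equiv_from_refl by (intro exI[of _ A]) auto
  next
    case (Suc d)
    then obtain B where B: "col_equiv_from k A B" "B $$ (i, k) rdvd A $$ (i, k)"
      "\<And>l. k < l \<and> l < Suc k + d \<Longrightarrow> B $$ (i, l) = 0" by auto
    note dims = col_equiv_from_dims[OF B(1)]
    let ?j = "Suc k + d"
    obtain p q r s p' q' r' s' where inv: "mutually_inverse2 p q r s p' q' r' s'"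
      and z: "B $$ (i, k) * q + B $$ (i, ?j) * s = 0"
      and d: "B $$ (i, k) * p + B $$ (i, ?j) * r rdvd B $$ (i, k)"
      using right_hermite[OF bez duo] .
    let ?C = "col_comb k ?j p q r s B"
    have "col_equiv_from k B ?C"
      by (rule col_equiv_from_col_comb[OF inv]) (use dims Suc.prems in auto)
    then have "col_equiv_from k A ?C" using B(1) col_equiv_from_trans by blast
    moreover have "?C $$ (i, k) rdvd A $$ (i, k)"
      using d B(2) i k dims by (auto simp: col_comb_def intro: rdvd_trans)
    moreover have "?C $$ (i, l) = 0" if "k < l \<and> l < Suc k + Suc d" for l
      using that z B(3)[of l] i Suc.prems dims by (cases "l = ?j") (auto simp: col_comb_def)
    ultimately show ?case by blast
  qed
  from this[of "dim_col A - Suc k"] k show thesis using that by auto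
qed

text \<open>
  Clearing the rows \<open>0\<close> and \<open>i\<close> by column operations reduces them to a triangular 2-by-2 block; the
  other rows above \<open>i\<close> stay divisible by the corner entry throughout.
\<close>
lemma divisor_of_first_rows_Suc:
  fixes A :: "'a::ring_1_no_zero_divisors mat"
  assumes bez: "bezout_ring TYPE('a)" and duo: "duo_ring TYPE('a)"
    and ls: "locally_stable TYPE('a)"
    and A: "A \<in> carrier_mat m n" and n: "0 < n" and i: "0 < i" "i < m"
    and div: "\<And>k l. k < i \<Longrightarrow> l < n \<Longrightarrow> A $$ (0, 0) rdvd A $$ (k, l)"
  obtains B where "mat_equiv A B" "\<And>k l. k \<le> i \<Longrightarrow> l < n \<Longrightarrow> B $$ (0, 0) rdvd B $$ (k, l)"
proof (cases "n = 1")
  case True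
  \<comment> \<open>A single column leaves no room for a triangular block, and a left gcd of its
    entries in rows 0 and \<open>i\<close> suffices.\<close>
  obtain p q k l where pq: "p * k + q * l = 1"
    and d: "p * A $$ (0, 0) + q * A $$ (i, 0) rdvd A $$ (0, 0)"
      "p * A $$ (0, 0) + q * A $$ (i, 0) rdvd A $$ (i, 0)"
    using left_gcd_row[OF bez duo] .
  from unimodular_row_completion[OF duo pq]
  obtain x y r s where inv: "mutually_inverse2 p q r s k x l y" .
  let ?B = "row_comb 0 i p q r s A"
  show thesis
  proof (rule that)
    show "mat_equiv A ?B" by (rule mat_equiv_row_comb[OF inv]) (use A i in auto)
    fix k l assume kl: "k \<le> i" "l < n"
    have "p * A $$ (0, 0) + q * A $$ (i, 0) rdvd A $$ (k, 0)" if "k < i" for k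
      using div[OF that n] d(1) rdvd_trans by blast
    then show "?B $$ (0, 0) rdvd ?B $$ (k, l)"
      using kl A i True d
      by (auto simp: row_comb_def intro!: rdvd_add duo_rdvd_mult_left[OF duo])
  qed
next
  case False
  with n have n1: "1 < n" by simp
  obtain B where B: "col_equiv_from 0 A B" "B $$ (0, 0) rdvd A $$ (0, 0)"
    "\<And>l. 0 < l \<Longrightarrow> l < n \<Longrightarrow> B $$ (0, l) = 0"
    using clear_row_right_of[OF bez duo, of 0 A 0] A i n by auto
  note Bdim = col_equiv_from_dims[OF B(1)]
  have Bdiv: "B $$ (0, 0) rdvd B $$ (k, l)" if "k < i" "l < n" for k l
  proof -
    have "\<forall>l<dim_col A. B $$ (0, 0) rdvd A $$ (k, l)"
      using div[OF that(1)] B(2) A rdvd_trans by blast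
    then show ?thesis
      using B(1) that A i unfolding col_equiv_from_def by auto
  qed
  \<comment> \<open>Starting at column 1 keeps column 0, with its corner entry, and the zeros of row
    0 intact. Rows 0 and \<open>i\<close> now vanish outside columns 0 and 1, where they form a
    triangular block.\<close>
  obtain C where C: "col_equiv_from 1 B C"
    "\<And>l. 1 < l \<Longrightarrow> l < n \<Longrightarrow> C $$ (i, l) = 0"
    using clear_row_right_of[OF bez duo, of i B 1] A i n1 Bdim by auto
  note Cdim = col_equiv_from_dims[OF C(1)]
  have C0: "C $$ (k, 0) = B $$ (k, 0)" if "k < m" for k
    using C(1) that A Bdim n unfolding col_equiv_from_def by auto
  have Crow: "g rdvd C $$ (k, l)" if "k < m" "1 \<le> l" "l < n" "\<And>l. 1 \<le> l \<Longrightarrow> l < n \<Longrightarrow> g rdvd B $$ (k, l)" for k l g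
    using C(1) that A Bdim unfolding col_equiv_from_def by auto
  have C0l: "C $$ (0, l) = 0" if "0 < l" "l < n" for l
    using Crow[of 0 l 0] that i B(3) by (auto simp: rdvd_def)
  have Cdiv: "C $$ (0, 0) rdvd C $$ (k, l)" if "k < i" "l < n" for k l
    using Crow[of k l "C $$ (0, 0)"] C0[of 0] C0[of k] Bdiv[OF that(1)] that i
    by (cases "l = 0") auto
  obtain p q k' l' x z m' n' d where
    pq: "p * k' + q * l' = 1" and xz: "m' * x + n' * z = 1"
    and d: "d = p * (C $$ (0, 0) * x) + q * (C $$ (i, 0) * x + C $$ (i, 1) * z)"
    and dd: "d rdvd C $$ (0, 0)" "d rdvd C $$ (i, 0)" "d rdvd C $$ (i, 1)"
    using triangular_reduction[OF bez duo ls] .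
  from unimodular_row_completion[OF duo pq]
  obtain x1 y1 r s where inv1: "mutually_inverse2 p q r s k' x1 l' y1" .
  from unimodular_row_completion[OF duo xz]
  obtain x2 y2 p2 q2 where inv2: "mutually_inverse2 m' n' p2 q2 x x2 z y2" .
  \<comment> \<open>The unimodular column (x, z) must be the first column of the operation, so the
    inverse of the completion of (m', n') is used.\<close>
  let ?D = "col_comb 0 1 x x2 z y2 C"
  let ?E = "row_comb 0 i p q r s ?D"
  have dC: "d rdvd C $$ (k, l)" if "k \<le> i" "l < n" for k l
  proof (cases "k < i")
    case True
    then show ?thesis using Cdiv[OF True that(2)] dd(1) rdvd_trans by blast
  next
    case False
    then have "k = i" using that by simp
    moreover have "l = 0 \<or> l = 1 \<or> 1 < l" by auto
    ultimately show ?thesis using dd C(2) that by auto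
  qed
  have Ddim: "dim_row ?D = m" "dim_col ?D = n" using A Bdim Cdim by (auto simp: col_comb_def)
  have dD: "d rdvd ?D $$ (k, l)" if "k \<le> i" "l < n" for k l
    using dC[of k l] dC[of k 0] dC[of k 1] that n1 i A Bdim Cdim
    by (auto simp: col_comb_def intro!: rdvd_add rdvd_mult_right)
  have dE: "d rdvd ?E $$ (k, l)" if "k \<le> i" "l < n" for k l
    using dD[of k l] dD[of 0 l] dD[of i l] that i Ddim
    by (auto simp: row_comb_def intro!: rdvd_add duo_rdvd_mult_left[OF duo])
  have "?E $$ (0, 0) = d"
    using i n1 A Bdim Cdim C0l[of 1] unfolding d by (simp add: row_comb_def col_comb_def)
  moreover have "mat_equiv A ?E"
  proof -
    have "mat_equiv A B" "mat_equiv B C" using B(1) C(1) by (auto simp: col_equiv_from_def)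
    moreover have "mat_equiv C ?D"
      by (rule mat_equiv_col_comb[OF mutually_inverse2_commute[OF inv2]])
         (use n1 A Bdim Cdim in auto)
    moreover have "mat_equiv ?D ?E"
      by (rule mat_equiv_row_comb[OF inv1]) (use i Ddim in auto)
    ultimately show ?thesis using mat_equiv_trans by blast
  qed
  ultimately show thesis using that dE by metis
qed

text \<open>Induction on the last row treated; for row 0 alone, clearing it leaves only the
  corner.\<close>

lemma divisor_of_all_entries:
  fixes A :: "'a::ring_1_no_zero_divisors mat"
  assumes bez: "bezout_ring TYPE('a)" and duo: "duo_ring TYPE('a)"
    and ls: "locally_stable TYPE('a)"
    and A: "A \<in> carrier_mat (Suc m) (Suc n)"
  obtains B where "mat_equiv A B"
    "\<And>k l. k < Suc m \<Longrightarrow> l < Suc n \<Longrightarrow> B $$ (0, 0) rdvd B $$ (k, l)"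
proof -
  have "\<exists>B. mat_equiv A B \<and> (\<forall>k\<le>i. \<forall>l<Suc n. B $$ (0, 0) rdvd B $$ (k, l))"
    if "i < Suc m" for i
    using that
  proof (induction i)
    case 0
    obtain B where B: "col_equiv_from 0 A B"
      "\<And>l. 0 < l \<Longrightarrow> l < Suc n \<Longrightarrow> B $$ (0, l) = 0"
      using clear_row_right_of[OF bez duo, of 0 A 0] A by auto
    have "B $$ (0, 0) rdvd B $$ (0, l)" if "l < Suc n" for l
      using B(2)[of l] that by (cases "l = 0") auto
    then show ?case using B(1) unfolding col_equiv_from_def by auto
  next
    case (Suc i)
    then obtain B where B: "mat_equiv A B"
      "\<And>k l. k < Suc i \<Longrightarrow> l < Suc n \<Longrightarrow> B $$ (0, 0) rdvd B $$ (k, l)"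
      by (auto simp: less_Suc_eq_le)
    have Bc: "B \<in> carrier_mat (Suc m) (Suc n)" by (rule mat_equiv_carrier[OF B(1) A])
    obtain C where "mat_equiv B C"
      "\<And>k l. k \<le> Suc i \<Longrightarrow> l < Suc n \<Longrightarrow> C $$ (0, 0) rdvd C $$ (k, l)"
      using divisor_of_first_rows_Suc[OF bez duo ls Bc _ _ _ B(2)] Suc.prems by blast
    then show ?case using mat_equiv_trans[OF B(1)] by blast
  qed
  from this[of m] show thesis using that by (auto simp: less_Suc_eq_le)
qed

section \<open>Diagonal reduction\<close>

text \<open>Entries of \<open>P * A * Q\<close> are sums of two-sided multiples of entries of
  \<open>A\<close>. This passes divisibility by the corner on to the diagonal form of the remaining
  block.\<close>

lemma mat_equiv_rdvd:
  fixes A :: "'a::ring_1 mat"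
  assumes duo: "duo_ring TYPE('a)" and A: "A \<in> carrier_mat m n" and eq: "mat_equiv A B"
    and div: "\<And>k l. k < m \<Longrightarrow> l < n \<Longrightarrow> g rdvd A $$ (k, l)" and kl: "k < m" "l < n"
  shows "g rdvd B $$ (k, l)"
proof -
  from mat_equivE[OF eq A] obtain P Q where P: "P \<in> carrier_mat m m" and
    Q: "Q \<in> carrier_mat n n" and B: "B = P * A * Q" .
  define X where "X = P * A"
  have X: "X \<in> carrier_mat m n" unfolding X_def using P A by simp
  have "g rdvd X $$ (k, l)" if "k < m" "l < n" for k l
    unfolding X_def using that P A div
    by (auto simp: scalar_prod_def intro!: rdvd_sum duo_rdvd_mult_left[OF duo])
  then show ?thesis
    unfolding B X_def[symmetric] using kl X Q
    by (auto simp: scalar_prod_def intro!: rdvd_sum rdvd_mult_right)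
qed

lemma mat_equiv_four_block:
  assumes G: "G \<in> carrier_mat a a" and A: "A \<in> carrier_mat m n" and eq: "mat_equiv A B"
  shows "mat_equiv (four_block_mat G (0\<^sub>m a n) (0\<^sub>m m a) A)
    (four_block_mat G (0\<^sub>m a n) (0\<^sub>m m a) B)"
proof -
  have inv: "invertible_mat (four_block_mat (1\<^sub>m a) (0\<^sub>m a k) (0\<^sub>m k a) P)"
    if P: "P \<in> carrier_mat k k" "invertible_mat P" for P :: "'a mat" and k
  proof -
    obtain R where R: "R \<in> carrier_mat k k" "P * R = 1\<^sub>m k" "R * P = 1\<^sub>m k"
      using invertible_mat_inverse[OF P] .
    show ?thesis
      by (rule invertible_matI[of _ "a + k" "four_block_mat (1\<^sub>m a) (0\<^sub>m a k) (0\<^sub>m k a) R"])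
         (use P R in \<open>auto simp: mult_four_block_mat[of _ a a _ k _ k _ _ a _ k]\<close>)
  qed
  from mat_equivE[OF eq A] obtain P Q where P: "P \<in> carrier_mat m m" "invertible_mat P" and
    Q: "Q \<in> carrier_mat n n" "invertible_mat Q" and B: "B = P * A * Q" .
  let ?P = "four_block_mat (1\<^sub>m a) (0\<^sub>m a m) (0\<^sub>m m a) P"
  let ?Q = "four_block_mat (1\<^sub>m a) (0\<^sub>m a n) (0\<^sub>m n a) Q"
  have "?P * four_block_mat G (0\<^sub>m a n) (0\<^sub>m m a) A = four_block_mat G (0\<^sub>m a n) (0\<^sub>m m a) (P * A)"
    using P A G by (auto simp: mult_four_block_mat[of _ a a _ m _ m _ _ a _ n])
  moreover have "four_block_mat G (0\<^sub>m a n) (0\<^sub>m m a) (P * A) * ?Q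
      = four_block_mat G (0\<^sub>m a n) (0\<^sub>m m a) B"
    unfolding B using P A G Q by (auto simp: mult_four_block_mat[of _ a a _ n _ m _ _ a _ n])
  ultimately show ?thesis
    using inv[OF P] inv[OF Q] P A G Q
    by (intro mat_equivI[of _ "a + m" "a + n" ?P ?Q]) auto
qed

lemma clear_first_row_and_column:
  fixes A :: "'a::ring_1 mat"
  assumes duo: "duo_ring TYPE('a)" and A: "A \<in> carrier_mat (Suc m) (Suc n)"
    and div: "\<And>k l. k < Suc m \<Longrightarrow> l < Suc n \<Longrightarrow> A $$ (0, 0) rdvd A $$ (k, l)"
  obtains B where "B \<in> carrier_mat m n"
    "mat_equiv A (four_block_mat (mat 1 1 (\<lambda>_. A $$ (0, 0))) (0\<^sub>m 1 n) (0\<^sub>m m 1) B)"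
    "\<And>k l. k < m \<Longrightarrow> l < n \<Longrightarrow> A $$ (0, 0) rdvd B $$ (k, l)"
proof -
  let ?g = "A $$ (0, 0)"
  have "\<forall>l<n. \<exists>r. A $$ (0, Suc l) = ?g * r"
    using div[of 0] by (auto simp: rdvd_def)
  then obtain v where v: "\<And>l. l < n \<Longrightarrow> A $$ (0, Suc l) = ?g * v l" by metis
  have "\<forall>k<m. \<exists>r. A $$ (Suc k, 0) = r * ?g"
    using div[of _ 0] unfolding rdvd_def by (metis Suc_mono duo_right_to_left[OF duo] zero_less_Suc)
  then obtain w where w: "\<And>k. k < m \<Longrightarrow> A $$ (Suc k, 0) = w k * ?g" by metis
  define G where "G = mat 1 1 (\<lambda>_. ?g)"
  define V where "V = mat 1 n (\<lambda>(_, l). v l)"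
  define W where "W = mat m 1 (\<lambda>(k, _). w k)"
  define A' where "A' = mat m n (\<lambda>(k, l). A $$ (Suc k, Suc l))"
  define B where "B = A' - W * (G * V)"
  have c: "G \<in> carrier_mat 1 1" "V \<in> carrier_mat 1 n" "W \<in> carrier_mat m 1"
    "A' \<in> carrier_mat m n" "B \<in> carrier_mat m n"
    unfolding G_def V_def W_def A'_def B_def by auto
  \<comment> \<open>The first row has quotients by the corner on the right, the first column on the
    left. Unitriangular factors built from \<open>V\<close> and \<open>W\<close> therefore clear
    both without inverting the corner, leaving \<open>A' - W * (G * V)\<close>.\<close>
  have block: "A = four_block_mat G (G * V) (W * G) A'"
    by (rule eq_matI)
       (use A v w in \<open>auto simp: G_def V_def W_def A'_def scalar_prod_def less_Suc_eq_0_disj\<close>)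
  let ?P = "four_block_mat (1\<^sub>m 1) (0\<^sub>m 1 m) (- W) (1\<^sub>m m)"
  let ?Q = "four_block_mat (1\<^sub>m 1) (- V) (0\<^sub>m n 1) (1\<^sub>m n)"
  have cancel: "- X + X = 0\<^sub>m a b" "X + - X = 0\<^sub>m a b" if "X \<in> carrier_mat a b" for X :: "'a mat" and a b
    by (rule eq_matI; use that in auto)+
  have neg_zero: "- 0\<^sub>m a b = (0\<^sub>m a b :: 'a mat)" for a b
    by (rule eq_matI) auto
  have "?P * A = four_block_mat G (G * V) (0\<^sub>m m 1) B"
    unfolding block
    by (subst mult_four_block_mat[of _ 1 1 _ m _ m _ _ 1 _ n])
       (use c in \<open>auto simp: cancel B_def minus_add_uminus_mat[of _ m n] comm_add_mat[of _ m n]\<close>)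
  moreover have "four_block_mat G (G * V) (0\<^sub>m m 1) B * ?Q
      = four_block_mat G (0\<^sub>m 1 n) (0\<^sub>m m 1) B"
    by (subst mult_four_block_mat[of _ 1 1 _ n _ m _ _ 1 _ n])
       (use c in \<open>auto simp: cancel\<close>)
  moreover have "invertible_mat ?P"
    by (rule invertible_matI[of _ "1 + m" "four_block_mat (1\<^sub>m 1) (0\<^sub>m 1 m) W (1\<^sub>m m)"])
       (use c in \<open>auto simp: mult_four_block_mat[of _ 1 1 _ m _ m _ _ 1 _ m] cancel neg_zero\<close>)
  moreover have "invertible_mat ?Q"
    by (rule invertible_matI[of _ "1 + n" "four_block_mat (1\<^sub>m 1) V (0\<^sub>m n 1) (1\<^sub>m n)"])
       (use c in \<open>auto simp: mult_four_block_mat[of _ 1 1 _ n _ n _ _ 1 _ n] cancel neg_zero\<close>)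
  ultimately have "mat_equiv A (four_block_mat G (0\<^sub>m 1 n) (0\<^sub>m m 1) B)"
    using c A by (intro mat_equivI[of _ "Suc m" "Suc n" ?P ?Q]) auto
  moreover have "?g rdvd B $$ (k, l)" if "k < m" "l < n" for k l
  proof -
    have "B $$ (k, l) = A $$ (Suc k, Suc l) + w k * (?g * - v l)"
      using that by (simp add: B_def A'_def W_def G_def V_def scalar_prod_def)
    then show ?thesis
      using div[of "Suc k" "Suc l"] that
      by (simp only:) (intro rdvd_add duo_rdvd_mult_left[OF duo] rdvd_mult_right rdvd_refl, auto)
  qed
  ultimately show thesis using that c unfolding G_def by blast
qed

lemma diagonal_reduction:
  fixes A :: "'a::ring_1_no_zero_divisors mat"
  assumes bez: "bezout_ring TYPE('a)" and duo: "duo_ring TYPE('a)"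
    and ls: "locally_stable TYPE('a)"
  shows "A \<in> carrier_mat m n \<Longrightarrow> \<exists>D. mat_equiv A D \<and> diagonal_mat D \<and>
    (\<forall>i. Suc i < min m n \<longrightarrow> D $$ (i, i) rdvd D $$ (Suc i, Suc i))"
proof (induction m arbitrary: n A)
  case 0
  then show ?case by (intro exI[of _ A]) (auto simp: mat_equiv_refl diagonal_mat_def)
next
  case (Suc m)
  show ?case
  proof (cases n)
    case 0
    then show ?thesis
      using Suc.prems by (intro exI[of _ A]) (auto simp: mat_equiv_refl diagonal_mat_def)
  next
    case n: (Suc n')
    note A = Suc.prems[unfolded n]
    obtain B where B: "mat_equiv A B"
      "\<And>k l. k < Suc m \<Longrightarrow> l < Suc n' \<Longrightarrow> B $$ (0, 0) rdvd B $$ (k, l)"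
      using divisor_of_all_entries[OF bez duo ls A] by blast
    have Bc: "B \<in> carrier_mat (Suc m) (Suc n')" by (rule mat_equiv_carrier[OF B(1) A])
    let ?G = "mat 1 1 (\<lambda>_. B $$ (0, 0))"
    let ?F = "four_block_mat ?G (0\<^sub>m 1 n') (0\<^sub>m m 1)"
    obtain C where C: "C \<in> carrier_mat m n'" "mat_equiv B (?F C)"
      "\<And>k l. k < m \<Longrightarrow> l < n' \<Longrightarrow> B $$ (0, 0) rdvd C $$ (k, l)"
      using clear_first_row_and_column[OF duo Bc B(2)] by blast
    obtain D where D: "mat_equiv C D" "diagonal_mat D"
      "\<And>i. Suc i < min m n' \<Longrightarrow> D $$ (i, i) rdvd D $$ (Suc i, Suc i)"
      using Suc.IH[OF C(1)] by blast
    have Dc: "D \<in> carrier_mat m n'" by (rule mat_equiv_carrier[OF D(1) C(1)])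
    have "mat_equiv (?F C) (?F D)"
      by (rule mat_equiv_four_block[OF _ C(1) D(1)]) simp
    then have "mat_equiv A (?F D)" using B(1) C(2) mat_equiv_trans by blast
    moreover have "diagonal_mat (?F D)"
      using D(2) Dc unfolding diagonal_mat_def by (auto simp: less_Suc_eq_0_disj) (metis carrier_matD)
    moreover have "?F D $$ (i, i) rdvd ?F D $$ (Suc i, Suc i)" if i: "Suc i < min (Suc m) n" for i
    \<comment> \<open>At index 0 the corner meets the first diagonal entry of \<open>D\<close>, and
      it divides every entry of \<open>C\<close>; at later indices the chain is that of
      \<open>D\<close>, shifted by one.\<close>
    proof (cases i)
      case 0
      then show ?thesis
        using mat_equiv_rdvd[OF duo C(1) D(1) C(3), of 0 0] i n Dc by auto
    next
      case (Suc j)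
      then show ?thesis using D(3)[of j] i n Dc by auto
    qed
    ultimately show ?thesis by blast
  qed
qed

theorem theorem3p2:
  assumes "bezout_ring TYPE('a::ring_1_no_zero_divisors)"
    and "duo_ring TYPE('a)"
    and "locally_stable TYPE('a)"
  shows "elementary_divisor_ring TYPE('a)"
  unfolding elementary_divisor_ring_def
proof
  fix A :: "'a mat"
  obtain D where D: "mat_equiv A D" "diagonal_mat D"
    "\<And>i. Suc i < min (dim_row A) (dim_col A) \<Longrightarrow> D $$ (i, i) rdvd D $$ (Suc i, Suc i)"
    using diagonal_reduction[OF assms, of A "dim_row A" "dim_col A"] by auto
  have "two_sided_ideal hull {x} \<subseteq> right_multiples g \<inter> left_multiples g" if "g rdvd x" for g x :: 'a
  proof -
    \<comment> \<open>The ideal generated by \<open>x\<close> lies in every two-sided ideal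
      containing \<open>x\<close>, in particular in \<open>gR = Rg\<close>.\<close>
    have "two_sided_ideal (right_multiples g)"
      using assms(2) right_ideal_right_multiples unfolding duo_ring_def by blast
    then have "two_sided_ideal hull {x} \<subseteq> right_multiples g"
      using that by (intro hull_minimal) (simp_all add: right_multiples_iff)
    then show ?thesis using duo_multiples_eq[OF assms(2)] by simp
  qed
  then show "admits_diagonal_reduction A"
    using D unfolding admits_diagonal_reduction_def mat_equiv_def by blast
qed

end
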